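(* For every integer $k \geq 3$, the graphs $O_k = K_{2k} - kK_2$ and $\overline{C}_{2k+1}$ are nearly dispersable, with $$mbt(O_k, \phi_{2k}) = 2k-1 = mbt(\overline{C}_{2k+1}, \phi_{2k+1}),$$ where for $n\in\{2k,2k+1\}$, $\phi_n := (1, 2, \ldots, k, n, n-1, \ldots, k+1)$ is the folded cyclic order on $\{1,\ldots,n\}$.
   Context: All graphs are finite and simple. For a set $S=\{i_1<\cdots<i_s\}$ of integers with $s\ge 1$, $1\le i_1$ and $i_s\le \lfloor n/2\rfloor$, the circulant $C(n,S)$ is the graph on vertex set $\{1,\ldots,n\}$ in which each $j$ is adjacent to $j+i_r$ (addition mod $n$) for $r=1,\ldots,s$. $O_k$ is the cocktail party graph (1-skeleton of the octahedron), the complete graph $K_{2k}$ with a perfect matching removed; it is regular of degree $2k-2$. $\overline{C}_{2k+1}$ is the complement of a cycle of length $2k+1$, i.e. $K_{2k+1}$ with a spanning cycle removed. The vertices are labelled so that these are the circulants $O_k = C(2k,\{1,\ldots,k-1\})$ (the removed matching consists of the length-$k$ jumps $\{i,i+k\}$) and $\overline{C}_{2k+1}=C(2k+1,\{1,\ldots,k-1\})$ (the removed Hamiltonian cycle consists of the length-$k$ jumps $\{i,i+k\}$ mod $2k+1$). Given a graph $G$ and a cyclic order $\omega$ on $V(G)$, draw the vertices on a circle in the order $\omega$ and the edges as straight chords; two edges cross if they intersect at a point that is not an endpoint. A matching book embedding $(G,\omega,c)$ consists of $G$, a cyclic order $\omega$, and an edge-coloring $c$ (the color classes are the pages) such that any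 two distinct edges of the same color neither cross nor share an endpoint. The number $mbt(G,\omega)$ is the least number of colors in any matching book embedding $(G,\omega,c)$ with the given cyclic order $\omega$. An embedding is dispersable if the number of colors equals the maximum degree $\Delta(G)$, and nearly dispersable if the number of colors equals $1+\Delta(G)$. A graph is dispersable if it has a dispersable matching book embedding; it is nearly dispersable if it is not dispersable and has a nearly dispersable matching book embedding. *)

theory Defs
  imports "HOL-Analysis.Analysis"
begin

section \<open>Finite simple graphs\<close>

record 'a graph =
  verts :: "'a set"
  edges :: "'a set set"

definition simple_graph :: "'a graph \<Rightarrow> bool" where
  "simple_graph G \<longleftrightarrow> finite (verts G) \<and> (\<forall>e \<in> edges G. e \<subseteq> verts G \<and> card e = 2)"

definition degree :: "'a graph \<Rightarrow> 'a \<Rightarrow> nat" where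
  "degree G v = card {e \<in> edges G. v \<in> e}"

definition max_degree :: "'a graph \<Rightarrow> nat" where
  "max_degree G = Max (degree G ` verts G)"

definition complement :: "'a graph \<Rightarrow> 'a graph" where
  "complement G =
     \<lparr>verts = verts G, edges = {e. e \<subseteq> verts G \<and> card e = 2} - edges G\<rparr>"

section \<open>Circulants\<close>

text \<open>Addition modulo \<open>n\<close> with representatives \<open>1, \<dots>, n\<close> instead of \<open>0, \<dots>, n - 1\<close>.\<close>

definition add_mod :: "nat \<Rightarrow> nat \<Rightarrow> nat \<Rightarrow> nat" where
  "add_mod n j i = (j + i - 1) mod n + 1"

definition circulant :: "nat \<Rightarrow> nat set \<Rightarrow> nat graph" where
  "circulant n S =
     \<lparr>verts = {1..n}, edges = {{j, add_mod n j i} | j i. j \<in> {1..n} \<and> i \<in> S}\<rparr>"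

text \<open>
  \<open>O_k\<close> and the complement of the cycle of length \<open>2k + 1\<close>, in their labelling as circulants.
  Lemmas \<open>cocktail_party_eq\<close> and \<open>odd_cycle_complement_eq\<close> below show that the removed edges are
  exactly the jumps of length \<open>k\<close>: the perfect matching \<open>{i, i + k}\<close> modulo \<open>2k\<close>, respectively the
  Hamiltonian cycle \<open>1, 1 + k, 1 + 2k, \<dots>\<close> modulo \<open>2k + 1\<close>.
\<close>

definition cocktail_party :: "nat \<Rightarrow> nat graph" where
  "cocktail_party k = circulant (2 * k) {1..k - 1}"

definition odd_cycle_complement :: "nat \<Rightarrow> nat graph" where
  "odd_cycle_complement k = circulant (2 * k + 1) {1..k - 1}"

section \<open>Matching book embeddings\<close>

text \<open>
  A cyclic order is represented by any list that enumerates the vertices in this order. The drawing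
  puts the entries of the list at equally spaced points of the unit circle, so passing to another
  representative (a rotation of the list) only rotates the drawing.
\<close>

definition cyclic_order_on :: "'a set \<Rightarrow> 'a list \<Rightarrow> bool" where
  "cyclic_order_on V \<omega> \<longleftrightarrow> distinct \<omega> \<and> set \<omega> = V"

definition point :: "'a list \<Rightarrow> 'a \<Rightarrow> complex" where
  "point \<omega> v = cis (2 * pi * real (THE i. i < length \<omega> \<and> \<omega> ! i = v) / real (length \<omega>))"

text \<open>For an edge \<open>{u, v}\<close> this is the closed segment between the points of \<open>u\<close> and \<open>v\<close>.\<close>

definition chord :: "'a list \<Rightarrow> 'a set \<Rightarrow> complex set" where
  "chord \<omega> e = convex hull (point \<omega> ` e)"

definition crosses :: "'a list \<Rightarrow> 'a set \<Rightarrow> 'a set \<Rightarrow> bool" where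
  "crosses \<omega> e f \<longleftrightarrow> (\<exists>p \<in> chord \<omega> e \<inter> chord \<omega> f. p \<notin> point \<omega> ` (e \<union> f))"

definition matching_book_embedding :: "'a graph \<Rightarrow> 'a list \<Rightarrow> ('a set \<Rightarrow> nat) \<Rightarrow> bool" where
  "matching_book_embedding G \<omega> c \<longleftrightarrow>
     simple_graph G \<and> cyclic_order_on (verts G) \<omega> \<and>
     (\<forall>e \<in> edges G. \<forall>f \<in> edges G.
        e \<noteq> f \<and> c e = c f \<longrightarrow> \<not> crosses \<omega> e f \<and> e \<inter> f = {})"

definition num_pages :: "'a graph \<Rightarrow> ('a set \<Rightarrow> nat) \<Rightarrow> nat" where
  "num_pages G c = card (c ` edges G)"

definition mbt :: "'a graph \<Rightarrow> 'a list \<Rightarrow> nat" where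
  "mbt G \<omega> = (LEAST m. \<exists>c. matching_book_embedding G \<omega> c \<and> num_pages G c = m)"

definition dispersable :: "'a graph \<Rightarrow> bool" where
  "dispersable G \<longleftrightarrow>
     (\<exists>\<omega> c. matching_book_embedding G \<omega> c \<and> num_pages G c = max_degree G)"

definition nearly_dispersable :: "'a graph \<Rightarrow> bool" where
  "nearly_dispersable G \<longleftrightarrow>
     \<not> dispersable G \<and>
     (\<exists>\<omega> c. matching_book_embedding G \<omega> c \<and> num_pages G c = 1 + max_degree G)"

text \<open>The folded cyclic order \<open>1, 2, \<dots>, k, n, n - 1, \<dots>, k + 1\<close>.\<close>

definition folded_order :: "nat \<Rightarrow> nat \<Rightarrow> nat list" where
  "folded_order k n = [1..<k + 1] @ rev [k + 1..<n + 1]"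

section \<open>Basic facts\<close>

lemma add_mod_eq:
  assumes "j \<in> {1..n}" "i < n"
  shows "add_mod n j i = (if j + i \<le> n then j + i else j + i - n)"
proof (cases "j + i \<le> n")
  case True
  then show ?thesis using assms by (auto simp: add_mod_def)
next
  case False
  then have "(j + i - 1) mod n = (j + i - 1 - n) mod n"
    by (intro le_mod_geq) auto
  also have "\<dots> = j + i - 1 - n"
    using assms False by (intro mod_less) auto
  finally show ?thesis using False by (auto simp: add_mod_def)
qed

lemma circulant_edge_iff:
  assumes "S \<subseteq> {1..<n}" "a \<in> {1..n}" "b \<in> {1..n}" "a < b"
  shows "{a, b} \<in> edges (circulant n S) \<longleftrightarrow> b - a \<in> S \<or> n - (b - a) \<in> S"
proof
  assume "{a, b} \<in> edges (circulant n S)"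
  then obtain j i where ji: "j \<in> {1..n}" "i \<in> S" "{a, b} = {j, add_mod n j i}"
    by (auto simp: circulant_def)
  have i: "1 \<le> i" "i < n" using ji(2) assms(1) by auto
  have "add_mod n j i = (if j + i \<le> n then j + i else j + i - n)"
    using ji(1) i(2) by (rule add_mod_eq)
  with ji(3) have "(a = j \<and> b = (if j + i \<le> n then j + i else j + i - n)) \<or>
      (b = j \<and> a = (if j + i \<le> n then j + i else j + i - n))"
    by (auto simp: doubleton_eq_iff)
  then have "i = b - a \<or> i = n - (b - a)"
    using assms(2-4) ji(1) i by (auto split: if_splits)
  then show "b - a \<in> S \<or> n - (b - a) \<in> S" using ji(2) by auto
next
  assume "b - a \<in> S \<or> n - (b - a) \<in> S"
  then show "{a, b} \<in> edges (circulant n S)"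
  proof
    assume *: "b - a \<in> S"
    then have "add_mod n a (b - a) = b"
      using assms by (subst add_mod_eq) auto
    then have "{a, b} = {a, add_mod n a (b - a)}" by simp
    with * assms(2) show ?thesis by (auto simp: circulant_def)
  next
    assume *: "n - (b - a) \<in> S"
    then have "add_mod n b (n - (b - a)) = a"
      using assms by (subst add_mod_eq) auto
    then have "{a, b} = {b, add_mod n b (n - (b - a))}" by auto
    with * assms(3) show ?thesis unfolding circulant_def by fastforce
  qed
qed

lemma simple_graph_circulant:
  assumes "S \<subseteq> {1..<n}"
  shows "simple_graph (circulant n S)"
proof -
  have "{j, add_mod n j i} \<subseteq> {1..n} \<and> card {j, add_mod n j i} = 2"
    if "j \<in> {1..n}" "i \<in> S" for j i
  proof -
    have "1 \<le> i" "i < n" using that assms by auto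
    then show ?thesis using that(1) add_mod_eq[of j n i] by auto
  qed
  then show ?thesis by (auto simp: simple_graph_def circulant_def)
qed

lemma circulant_eq_complement:
  assumes "n div 2 = k" "1 \<le> k"
  shows "circulant n {1..k - 1} = complement (circulant n {k})"
proof -
  have S: "{1..k - 1} \<subseteq> {1..<n}" "{k} \<subseteq> {1..<n}" using assms by auto
  have edge: "{a, b} \<in> edges (circulant n {1..k - 1}) \<longleftrightarrow> {a, b} \<notin> edges (circulant n {k})"
    if "a \<in> {1..n}" "b \<in> {1..n}" "a < b" for a b
  proof -
    define d where "d = b - a"
    have d: "1 \<le> d" "d < n" using that by (auto simp: d_def)
    have n: "n = 2 * k \<or> n = 2 * k + 1" using assms(1) by linarith
    have "(1 \<le> d \<and> d \<le> k - 1 \<or> 1 \<le> n - d \<and> n - d \<le> k - 1) \<longleftrightarrow> \<not> (d = k \<or> n - d = k)"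
      using d n assms(2) by linarith
    then show ?thesis
      unfolding circulant_edge_iff[OF S(1) that] circulant_edge_iff[OF S(2) that]
        d_def[symmetric] atLeastAtMost_iff singleton_iff .
  qed
  have pair: "\<exists>a \<in> {1..n}. \<exists>b \<in> {1..n}. a < b \<and> e = {a, b}"
    if sub: "e \<subseteq> {1..n}" and two: "card e = 2" for e :: "nat set"
  proof -
    obtain x y where "e = {x, y}" "x \<noteq> y" using two by (auto simp: card_2_iff)
    then show ?thesis using sub
      by (metis insert_commute insert_subset linorder_neqE_nat)
  qed
  have verts: "verts (circulant n T) = {1..n}" for T by (simp add: circulant_def)
  have "edges (circulant n {1..k - 1}) =
      {e. e \<subseteq> {1..n} \<and> card e = 2} - edges (circulant n {k})"
    using simple_graph_circulant[OF S(1)] pair edge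
    unfolding simple_graph_def verts by blast
  then show ?thesis by (simp add: complement_def verts circulant_def)
qed

lemma cocktail_party_eq:
  "1 \<le> k \<Longrightarrow> cocktail_party k = complement (circulant (2 * k) {k})"
  unfolding cocktail_party_def by (rule circulant_eq_complement) auto

lemma odd_cycle_complement_eq:
  "1 \<le> k \<Longrightarrow> odd_cycle_complement k = complement (circulant (2 * k + 1) {k})"
  unfolding odd_cycle_complement_def by (rule circulant_eq_complement) auto

end

theory Submission
  imports Defs
begin

text \<open>
  In a regular graph drawn with as many pages as its degree, every page meets every vertex, so it is
  a perfect matching. An edge of a noncrossing perfect matching has an even number of vertices on
  each side, so every edge joins positions of different parity and the graph is bipartite. But both
  graphs contain the triangle \<open>1, 2, 3\<close>.

  Conversely, in the folded order the removed edges are one (\<open>n = 2k\<close>), respectively two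
  (\<open>n = 2k + 1\<close>), of the \<open>n\<close> classes of parallel chords of the regular \<open>n\<close>-gon, and each of the
  remaining \<open>2k - 1\<close> classes is a page.
\<close>

section \<open>Chords of the unit circle\<close>

text \<open>Names the index hidden in \<open>point\<close>, so that statements about the drawing
  become arithmetic on list indices. Indices start at 0.\<close>

definition position :: "'a list \<Rightarrow> 'a \<Rightarrow> nat" where
  "position \<omega> v = (THE i. i < length \<omega> \<and> \<omega> ! i = v)"

lemma point_position: "point \<omega> v = cis (2 * pi * real (position \<omega> v) / real (length \<omega>))"
  by (simp add: point_def position_def)

lemma position_nth:
  assumes "distinct \<omega>" "i < length \<omega>"
  shows "position \<omega> (\<omega> ! i) = i"
  unfolding position_def using assms by (auto simp: nth_eq_iff_index_eq)

lemma position_less: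
  assumes "distinct \<omega>" "v \<in> set \<omega>"
  shows "position \<omega> v < length \<omega>" and "\<omega> ! position \<omega> v = v"
  using assms position_nth by (metis in_set_conv_nth)+

lemma bij_betw_position:
  assumes "distinct \<omega>"
  shows "bij_betw (position \<omega>) (set \<omega>) {..<length \<omega>}"
  using assms by (intro bij_betw_byWitness[where f' = "(!) \<omega>"])
    (auto simp: position_nth position_less)

text \<open>The points are \<open>length \<omega>\<close>-th roots of unity, and distinct exponents
  below the order give distinct roots.\<close>

lemma inj_on_point:
  assumes "distinct \<omega>"
  shows "inj_on (point \<omega>) (set \<omega>)"
proof (cases "\<omega> = []")
  case False
  have "inj_on (\<lambda>k. cis (2 * pi * real k / real (length \<omega>))) {..<length \<omega>}"
    using Complex.bij_betw_roots_unity[of "length \<omega>"] False by (auto simp: bij_betw_def)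
  then show ?thesis
    using bij_betw_position[OF assms]
    unfolding inj_on_def point_position bij_betw_def by blast
qed auto

text \<open>The expression is twice the signed area of the triangle \<open>cis x\<close>,
  \<open>cis y\<close>, \<open>cis z\<close>. In terms of the half-angles \<open>p\<close> and
  \<open>q\<close> it factors as \<open>4 * sin p * sin q * sin (p + q)\<close>, and all three
  angles lie strictly between 0 and \<open>pi\<close>.\<close>

lemma sin_triangle_pos:
  assumes "x < y" "y < z" "z < x + 2 * pi"
  shows "sin (y - x) + sin (z - y) - sin (z - x) > 0"
proof -
  define p q where "p = (y - x) / 2" and "q = (z - y) / 2"
  have "sin (2 * p) + sin (2 * q) - sin (2 * (p + q)) = 4 * sin p * sin q * sin (p + q)"
  proof -
    have "sin (2 * p) + sin (2 * q) - sin (2 * (p + q)) =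
        sin (2 * p) * (1 - cos (2 * q)) + sin (2 * q) * (1 - cos (2 * p))"
      unfolding distrib_left sin_add[of "2 * p"] by (simp add: algebra_simps)
    also have "\<dots> = 4 * sin p * sin q * sin (p + q)"
      unfolding cos_double_sin sin_double sin_add by (simp add: algebra_simps power2_eq_square)
    finally show ?thesis .
  qed
  moreover have "sin p > 0" "sin q > 0" "sin (p + q) > 0"
    using assms by (auto intro!: sin_gt_zero simp: p_def q_def field_simps)
  moreover have "2 * p = y - x" "2 * q = z - y" "2 * (p + q) = z - x"
    by (auto simp: p_def q_def field_simps)
  ultimately show ?thesis by (metis mult_pos_pos zero_less_numeral)
qed

text \<open>
  The weights are the areas of the triangles opposite to the four points: this is the affine
  dependence of four points in the plane.
\<close>

lemma interleaved_chords_meet: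
  assumes "x1 < x2" "x2 < x3" "x3 < x4" "x4 < x1 + 2 * pi"
  shows "\<exists>s t. 0 < s \<and> s < 1 \<and> 0 < t \<and> t < 1 \<and>
    (1 - s) *\<^sub>R cis x1 + s *\<^sub>R cis x3 = (1 - t) *\<^sub>R cis x2 + t *\<^sub>R cis x4"
proof -
  define O3 where "O3 x y z = sin (y - x) + sin (z - y) - sin (z - x)" for x y z :: real
  define T where "T = O3 x2 x3 x4 + O3 x1 x2 x4"
  have pos: "O3 x2 x3 x4 > 0" "O3 x1 x2 x4 > 0" "O3 x1 x3 x4 > 0" "O3 x1 x2 x3 > 0"
    unfolding O3_def by (rule sin_triangle_pos; use assms in linarith)+
  then have T: "T > 0" by (simp add: T_def)
  \<comment> \<open>\<open>T\<close> is twice the area of the quadrilateral. Cutting along one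
    diagonal or the other gives the two sums, so both sides of the affine dependence can be
    normalized by the same number.\<close>
  have T2: "T = O3 x1 x3 x4 + O3 x1 x2 x3"
    unfolding T_def O3_def by (simp add: sin_diff algebra_simps)
  have id: "O3 x2 x3 x4 *\<^sub>R cis x1 + O3 x1 x2 x4 *\<^sub>R cis x3 =
      O3 x1 x3 x4 *\<^sub>R cis x2 + O3 x1 x2 x3 *\<^sub>R cis x4"
    unfolding O3_def by (simp add: complex_eq_iff sin_diff algebra_simps)
  define s t where "s = O3 x1 x2 x4 / T" and "t = O3 x1 x2 x3 / T"
  have s: "1 - s = O3 x2 x3 x4 / T" using T by (simp add: s_def T_def field_simps)
  have t: "1 - t = O3 x1 x3 x4 / T" using T by (simp add: t_def T2 field_simps)
  have "(1 - s) *\<^sub>R cis x1 + s *\<^sub>R cis x3 =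
      (1 / T) *\<^sub>R (O3 x2 x3 x4 *\<^sub>R cis x1 + O3 x1 x2 x4 *\<^sub>R cis x3)"
    unfolding s by (simp add: s_def scaleR_add_right)
  also have "\<dots> = (1 - t) *\<^sub>R cis x2 + t *\<^sub>R cis x4"
    unfolding id t by (simp add: t_def scaleR_add_right)
  finally have eq: "(1 - s) *\<^sub>R cis x1 + s *\<^sub>R cis x3 = (1 - t) *\<^sub>R cis x2 + t *\<^sub>R cis x4" .
  have "0 < s" "0 < t" using pos T by (auto simp: s_def t_def)
  moreover have "0 < 1 - s" "0 < 1 - t" unfolding s t using pos T by auto
  ultimately show ?thesis using eq by auto
qed

text \<open>Positions below \<open>length \<omega>\<close> turn into angles within one full turn, so
  the meeting point of interleaved chords applies. It is interior to both chords, as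
  \<open>crosses\<close> demands.\<close>

lemma crosses_if_interleaved:
  assumes dist: "distinct \<omega>" and mem: "a \<in> set \<omega>" "b \<in> set \<omega>" "a' \<in> set \<omega>" "b' \<in> set \<omega>"
    and less: "position \<omega> a < position \<omega> a'" "position \<omega> a' < position \<omega> b"
      "position \<omega> b < position \<omega> b'"
  shows "crosses \<omega> {a, b} {a', b'}"
proof -
  define n where "n = length \<omega>"
  have b': "position \<omega> b' < n" using position_less(1)[OF dist mem(4)] by (simp add: n_def)
  then have n: "n > 0" by simp
  define x where "x v = 2 * pi * real (position \<omega> v) / real n" for v
  have P: "point \<omega> v = cis (x v)" for v by (simp add: x_def n_def point_position)
  have x_less: "x v < x w" if "position \<omega> v < position \<omega> w" for v w
    using that n by (simp add: x_def divide_strict_right_mono)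
  have "x b' < 2 * pi" using b' by (simp add: x_def field_simps)
  moreover have "0 \<le> x a" by (simp add: x_def)
  ultimately have "x b' < x a + 2 * pi" by linarith
  then obtain s t where st: "0 < s" "s < 1" "0 < t" "t < 1"
    and eq: "(1 - s) *\<^sub>R point \<omega> a + s *\<^sub>R point \<omega> b =
      (1 - t) *\<^sub>R point \<omega> a' + t *\<^sub>R point \<omega> b'"
    using interleaved_chords_meet[of "x a" "x a'" "x b" "x b'"] less x_less unfolding P by blast
  define p where "p = (1 - s) *\<^sub>R point \<omega> a + s *\<^sub>R point \<omega> b"
  \<comment> \<open>A proper convex combination of two distinct points is neither of them. Applied
    to each chord in turn, this keeps \<open>p\<close> away from all four endpoints.\<close>
  have inner: "q \<noteq> y" "q \<noteq> z"
    if "0 < r" "r < 1" "y \<noteq> z" and q: "q = (1 - r) *\<^sub>R y + r *\<^sub>R z"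
    for r and q y z :: complex
  proof -
    have "q - y = r *\<^sub>R (z - y)" "q - z = (1 - r) *\<^sub>R (y - z)"
      unfolding q by (simp_all add: algebra_simps)
    then show "q \<noteq> y" "q \<noteq> z" using that(1-3) by auto
  qed
  have p': "p = (1 - t) *\<^sub>R point \<omega> a' + t *\<^sub>R point \<omega> b'"
    unfolding p_def by (rule eq)
  have ne: "point \<omega> a \<noteq> point \<omega> b" "point \<omega> a' \<noteq> point \<omega> b'"
    using inj_on_eq_iff[OF inj_on_point[OF dist] mem(1,2)]
      inj_on_eq_iff[OF inj_on_point[OF dist] mem(3,4)] less by auto
  have "p \<noteq> point \<omega> a" "p \<noteq> point \<omega> b" "p \<noteq> point \<omega> a'" "p \<noteq> point \<omega> b'"
    by (rule inner[OF st(1,2) ne(1) p_def] inner[OF st(3,4) ne(2) p'])+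
  then have "p \<notin> point \<omega> ` ({a, b} \<union> {a', b'})" by simp
  moreover have "p \<in> closed_segment (point \<omega> a) (point \<omega> b)"
    unfolding closed_segment_def using st p_def by (intro CollectI exI[of _ s]) simp
  moreover have "p \<in> closed_segment (point \<omega> a') (point \<omega> b')"
    unfolding closed_segment_def using st p' by (intro CollectI exI[of _ t]) simp
  ultimately show ?thesis
    unfolding crosses_def chord_def segment_convex_hull by auto
qed

text \<open>This is the equation of the line through two points of the unit circle. Both sides agree
  at the endpoints because \<open>u * cnj u = 1\<close>, and the left side is real affine in
  \<open>z\<close>. The product \<open>u * v\<close> encodes the direction.\<close>

lemma chord_equation:
  assumes "norm u = 1" "norm v = 1" "z \<in> convex hull {u, v}"
  shows "z + u * v * cnj z = u + v"
proof -
  obtain t where z: "z = (1 - t) *\<^sub>R u + t *\<^sub>R v"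
    using assms(3) unfolding segment_convex_hull[symmetric] closed_segment_def by auto
  have uv: "u * cnj u = 1" "v * cnj v = 1"
    using assms(1,2) by (simp_all add: complex_norm_square[symmetric])
  have "u * v * cnj z = (1 - t) *\<^sub>R (v * (u * cnj u)) + t *\<^sub>R (u * (v * cnj v))"
    unfolding z by (simp add: algebra_simps scaleR_conv_of_real)
  then show ?thesis unfolding uv z by (simp add: algebra_simps)
qed

text \<open>Equal products mean parallel chords. A common point makes the two chord equations agree,
  hence also the sums, and a pair is determined by its sum and product.\<close>

lemma parallel_chords_disjoint:
  fixes u v u' v' z :: complex
  assumes "norm u = 1" "norm v = 1" "norm u' = 1" "norm v' = 1" and uv: "u * v = u' * v'"
    and "z \<in> convex hull {u, v}" "z \<in> convex hull {u', v'}"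
  shows "{u, v} = {u', v'}"
proof -
  have sum: "u + v = u' + v'"
    using chord_equation[of u v z] chord_equation[of u' v' z] assms by simp
  \<comment> \<open>\<open>u\<close> is a root of the quadratic whose roots are \<open>u'\<close>
    and \<open>v'\<close>.\<close>
  have "(u - u') * (u - v') = u * u - u * (u' + v') + u' * v'" by (simp add: algebra_simps)
  also have "\<dots> = 0" unfolding sum[symmetric] uv[symmetric] by (simp add: algebra_simps)
  finally have "u = u' \<or> u = v'" by simp
  then show ?thesis using sum by auto
qed

section \<open>Lower bounds for regular graphs\<close>

lemma matching_book_embeddingD:
  assumes "matching_book_embedding G \<omega> c"
  shows "finite (verts G)" "finite (edges G)" "distinct \<omega>" "set \<omega> = verts G"
    "\<And>e. e \<in> edges G \<Longrightarrow> e \<subseteq> verts G" "\<And>e. e \<in> edges G \<Longrightarrow> card e = 2"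
    "\<And>e f. e \<in> edges G \<Longrightarrow> f \<in> edges G \<Longrightarrow> e \<noteq> f \<Longrightarrow> c e = c f \<Longrightarrow> \<not> crosses \<omega> e f"
    "\<And>e f. e \<in> edges G \<Longrightarrow> f \<in> edges G \<Longrightarrow> e \<noteq> f \<Longrightarrow> c e = c f \<Longrightarrow> e \<inter> f = {}"
proof -
  show "finite (verts G)" using assms by (auto simp: matching_book_embedding_def simple_graph_def)
  moreover show sub: "\<And>e. e \<in> edges G \<Longrightarrow> e \<subseteq> verts G"
    using assms by (auto simp: matching_book_embedding_def simple_graph_def)
  ultimately show "finite (edges G)" by (meson PowI finite_Pow_iff finite_subset subsetI)
qed (use assms in \<open>auto simp: matching_book_embedding_def simple_graph_def cyclic_order_on_def\<close>)

text \<open>Edges through \<open>v\<close> share an endpoint, so the coloring is injective on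
  them.\<close>

lemma card_colors_at_vertex:
  assumes "matching_book_embedding G \<omega> c"
  shows "card (c ` {e \<in> edges G. v \<in> e}) = degree G v"
  unfolding degree_def
  using matching_book_embeddingD(8)[OF assms] by (intro card_image inj_onI) blast

lemma degree_le_num_pages:
  assumes "matching_book_embedding G \<omega> c"
  shows "degree G v \<le> num_pages G c"
  unfolding card_colors_at_vertex[OF assms, symmetric] num_pages_def
  using matching_book_embeddingD(2)[OF assms] by (intro card_mono) auto

text \<open>The colors seen at \<open>v\<close> are as many as all colors, so none is missing at
  \<open>v\<close>.\<close>

lemma page_covers_vertex:
  assumes "matching_book_embedding G \<omega> c" "degree G v = num_pages G c" "e \<in> edges G"
  shows "\<exists>f \<in> edges G. c f = c e \<and> v \<in> f"
proof -
  have "c ` {e \<in> edges G. v \<in> e} = c ` edges G"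
    using matching_book_embeddingD(2)[OF assms(1)] card_colors_at_vertex[OF assms(1), of v] assms(2)
    by (intro card_subset_eq) (auto simp: num_pages_def)
  with assms(3) have "c e \<in> c ` {e \<in> edges G. v \<in> e}" by simp
  then show ?thesis by force
qed

text \<open>The edges of the page that meet \<open>I\<close> are disjoint pairs whose union is
  exactly \<open>I\<close>.\<close>

lemma even_card_if_page_partitions:
  assumes emb: "matching_book_embedding G \<omega> c" and "I \<subseteq> verts G"
    and cover: "\<And>v. v \<in> I \<Longrightarrow> \<exists>f \<in> edges G. c f = col \<and> v \<in> f"
    and closed: "\<And>f. f \<in> edges G \<Longrightarrow> c f = col \<Longrightarrow> f \<inter> I \<noteq> {} \<Longrightarrow> f \<subseteq> I"
  shows "even (card I)"
proof -
  note D = matching_book_embeddingD[OF emb]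
  define F where "F = {f \<in> edges G. c f = col \<and> f \<inter> I \<noteq> {}}"
  have I: "\<Union>F = I"
  proof (intro equalityI subsetI)
    fix v assume "v \<in> \<Union>F"
    then obtain f where "f \<in> edges G" "c f = col" "f \<inter> I \<noteq> {}" "v \<in> f"
      by (auto simp: F_def)
    then show "v \<in> I" using closed by blast
  next
    fix v assume "v \<in> I"
    then obtain f where "f \<in> edges G" "c f = col" "v \<in> f" using cover by blast
    with \<open>v \<in> I\<close> show "v \<in> \<Union>F" by (auto simp: F_def)
  qed
  have "2 * card F = card (\<Union>F)"
  proof (rule card_partition)
    show "finite F" using D(2) by (simp add: F_def)
    show "finite (\<Union>F)" unfolding I using assms(2) D(1) by (rule finite_subset)
  qed (use D(6,8) in \<open>auto simp: F_def\<close>)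
  then show ?thesis unfolding I by (metis dvd_triv_left)
qed

text \<open>A page edge with one end strictly between \<open>u\<close> and \<open>v\<close> cannot
  leave this arc without crossing \<open>{u, v}\<close> or meeting it at an endpoint. The page
  therefore matches the arc within itself, the arc has evenly many vertices, and the two positions
  differ by an odd number.\<close>

lemma perfect_page_parity:
  assumes emb: "matching_book_embedding G \<omega> c"
    and cover: "\<And>w. w \<in> verts G \<Longrightarrow> \<exists>f \<in> edges G. c f = c {u, v} \<and> w \<in> f"
    and uv: "{u, v} \<in> edges G" and less: "position \<omega> u < position \<omega> v"
  shows "even (position \<omega> u) \<noteq> even (position \<omega> v)"
proof -
  note D = matching_book_embeddingD[OF emb]
  have uvV: "u \<in> set \<omega>" "v \<in> set \<omega>" using D(4) D(5)[OF uv] by auto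
  define I where "I = {w \<in> set \<omega>. position \<omega> w \<in> {position \<omega> u<..<position \<omega> v}}"
  have "position \<omega> ` I = {position \<omega> u<..<position \<omega> v}"
  proof -
    have "j \<in> position \<omega> ` I" if "j \<in> {position \<omega> u<..<position \<omega> v}" for j
    proof -
      have "j < length \<omega>" using that position_less(1)[OF D(3) uvV(2)] by auto
      then show ?thesis using that unfolding I_def
        by (intro image_eqI[of _ _ "\<omega> ! j"]) (auto simp: position_nth[OF D(3)])
    qed
    then show ?thesis by (auto simp: I_def)
  qed
  moreover have "inj_on (position \<omega>) I"
    using bij_betw_position[OF D(3)] unfolding bij_betw_def I_def by (auto intro: inj_on_subset)
  ultimately have card_I: "card I = position \<omega> v - position \<omega> u - 1"
    by (metis card_image card_greaterThanLessThan Suc_eq_plus1 diff_diff_left)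
  have "even (card I)"
  proof (rule even_card_if_page_partitions[OF emb, of I "c {u, v}"])
    show "I \<subseteq> verts G" by (auto simp: I_def D(4))
    then show "\<exists>f \<in> edges G. c f = c {u, v} \<and> w \<in> f" if "w \<in> I" for w
      using that cover by blast
    fix f assume f: "f \<in> edges G" "c f = c {u, v}" "f \<inter> I \<noteq> {}"
    then obtain w where w: "w \<in> f" "w \<in> I" by blast
    then have ne: "f \<noteq> {u, v}" by (auto simp: I_def)
    then have disj: "f \<inter> {u, v} = {}" using D(8)[OF f(1) uv] f(2) by blast
    \<comment> \<open>Both argument orders are recorded because
      \<open>crosses_if_interleaved\<close> puts the chord with the smallest position first, and
      that depends on the side on which \<open>w'\<close> lies.\<close>
    have ncr: "\<not> crosses \<omega> f {u, v}" "\<not> crosses \<omega> {u, v} f"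
      using D(7)[OF f(1) uv ne] D(7)[OF uv f(1)] ne f(2) by auto
    obtain w' where w': "f = {w, w'}"
      using D(6)[OF f(1)] w(1) by (auto simp: card_2_iff)
    have w'V: "w' \<in> set \<omega>" using D(4) D(5)[OF f(1)] w' by auto
    have "w' \<in> I"
    proof (rule ccontr)
      assume "w' \<notin> I"
      moreover have "position \<omega> w' \<noteq> position \<omega> u" "position \<omega> w' \<noteq> position \<omega> v"
        using bij_betw_position[OF D(3)] w'V uvV disj w'
        unfolding bij_betw_def inj_on_def by auto
      ultimately consider "position \<omega> w' < position \<omega> u" | "position \<omega> v < position \<omega> w'"
        using w'V by (auto simp: I_def)
      then show False
      proof cases
        case 1
        then have "crosses \<omega> {w', w} {u, v}"
          using w(2) w'V uvV less by (intro crosses_if_interleaved[OF D(3)]) (auto simp: I_def)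
        then show False using ncr w' by (simp add: insert_commute)
      next
        case 2
        then have "crosses \<omega> {u, v} {w, w'}"
          using w(2) w'V uvV less by (intro crosses_if_interleaved[OF D(3)]) (auto simp: I_def)
        then show False using ncr w' by simp
      qed
    qed
    then show "f \<subseteq> I" using w w' by auto
  qed
  then have "odd (position \<omega> v - position \<omega> u)"
    unfolding card_I using less by auto
  then show ?thesis using less by auto
qed

text \<open>Parity of the position is a proper 2-coloring. This rules out odd cycles, whatever the
  cyclic order.\<close>

lemma regular_num_pages_bipartite:
  assumes emb: "matching_book_embedding G \<omega> c"
    and reg: "\<And>v. v \<in> verts G \<Longrightarrow> degree G v = num_pages G c"
    and uv: "{u, v} \<in> edges G"
  shows "even (position \<omega> u) \<noteq> even (position \<omega> v)"
proof -
  note D = matching_book_embeddingD[OF emb]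
  have cover: "\<exists>f \<in> edges G. c f = c e \<and> w \<in> f" if "e \<in> edges G" "w \<in> verts G" for e w
    using page_covers_vertex[OF emb reg] that by blast
  have "u \<noteq> v" using D(6)[OF uv] by auto
  then have "position \<omega> u \<noteq> position \<omega> v"
    using bij_betw_position[OF D(3)] D(4) D(5)[OF uv] unfolding bij_betw_def inj_on_def by auto
  moreover have vu: "{v, u} \<in> edges G" using uv by (simp add: insert_commute)
  ultimately show ?thesis
    using perfect_page_parity[OF emb cover[OF uv] uv] perfect_page_parity[OF emb cover[OF vu] vu]
    by (metis linorder_neqE_nat)
qed

section \<open>Circulants\<close>

lemma add_mod_range: "n > 0 \<Longrightarrow> add_mod n j i \<in> {1..n}"
  by (auto simp: add_mod_def Suc_le_eq)

lemma add_mod_inverse: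
  assumes "j \<in> {1..n}" "i \<in> {1..<n}"
  shows "add_mod n (add_mod n j i) (n - i) = j"
proof -
  have "add_mod n j i \<in> {1..n}" using assms by (intro add_mod_range) auto
  then show ?thesis using assms by (auto simp: add_mod_eq)
qed

text \<open>Edges at \<open>v\<close> correspond to jumps starting at \<open>v\<close>: an edge
  generated by a jump \<open>i\<close> into \<open>v\<close> is the jump \<open>n - i\<close> out of
  \<open>v\<close>. A jump of length \<open>n / 2\<close> is counted once.\<close>

lemma degree_circulant:
  assumes S: "S \<subseteq> {1..<n}" and v: "v \<in> {1..n}"
  shows "degree (circulant n S) v = card {i \<in> {1..<n}. i \<in> S \<or> n - i \<in> S}"
proof -
  let ?J = "{i \<in> {1..<n}. i \<in> S \<or> n - i \<in> S}"
  let ?f = "\<lambda>i. {v, add_mod n v i}"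
  have "{e \<in> edges (circulant n S). v \<in> e} = ?f ` ?J"
  proof (intro equalityI subsetI)
    fix e assume "e \<in> {e \<in> edges (circulant n S). v \<in> e}"
    then obtain j i where ji: "j \<in> {1..n}" "i \<in> S" "e = {j, add_mod n j i}" "v \<in> e"
      by (auto simp: circulant_def)
    have i: "i \<in> {1..<n}" using ji(2) S by auto
    show "e \<in> ?f ` ?J"
    proof (cases "v = j")
      case True
      then show ?thesis using i ji by blast
    next
      case False
      then have "v = add_mod n j i" using ji by simp
      then have "e = ?f (n - i)" using add_mod_inverse[OF ji(1) i] ji(3) by auto
      moreover have "n - i \<in> ?J" using i ji(2) by auto
      ultimately show ?thesis by blast
    qed
  next
    fix e assume "e \<in> ?f ` ?J"
    then obtain i where i: "i \<in> {1..<n}" "i \<in> S \<or> n - i \<in> S" "e = ?f i" by blast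
    have "e \<in> edges (circulant n S)" using i(2)
    proof
      assume "i \<in> S"
      then show ?thesis using i v unfolding circulant_def by auto
    next
      assume "n - i \<in> S"
      moreover have "e = {add_mod n v i, add_mod n (add_mod n v i) (n - i)}"
        using add_mod_inverse[OF v i(1)] i(3) by auto
      moreover have "add_mod n v i \<in> {1..n}" using i(1) by (intro add_mod_range) auto
      ultimately show ?thesis unfolding circulant_def by auto
    qed
    then show "e \<in> {e \<in> edges (circulant n S). v \<in> e}" using i(3) by auto
  qed
  moreover have "inj_on ?f ?J"
    using v by (intro inj_onI) (auto simp: doubleton_eq_iff add_mod_eq split: if_splits)
  ultimately show ?thesis unfolding degree_def by (simp add: card_image)
qed

text \<open>Since \<open>2 * m < n\<close>, the jumps \<open>{1..m}\<close> and their reverses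
  \<open>{n - m..<n}\<close> do not overlap.\<close>

lemma degree_circulant_interval:
  assumes "2 * m < n" "v \<in> {1..n}"
  shows "degree (circulant n {1..m}) v = 2 * m"
proof -
  have "{i \<in> {1..<n}. i \<in> {1..m} \<or> n - i \<in> {1..m}} = {1..m} \<union> {n - m..<n}"
    using assms(1) by auto
  moreover have "card ({1..m} \<union> {n - m..<n}) = card {1..m} + card {n - m..<n}"
    using assms(1) by (intro card_Un_disjoint) auto
  moreover have "{1..m} \<subseteq> {1..<n}" using assms(1) by auto
  ultimately show ?thesis using degree_circulant[OF _ assms(2)] assms(1) by simp
qed

section \<open>The folded order\<close>

lemma cyclic_order_on_folded_order:
  assumes "k \<le> n"
  shows "cyclic_order_on {1..n} (folded_order k n)"
  using assms by (auto simp: cyclic_order_on_def folded_order_def simp del: upt_Suc)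

lemma length_folded_order: "k \<le> n \<Longrightarrow> length (folded_order k n) = n"
  by (simp add: folded_order_def del: upt_Suc)

lemma position_folded_order:
  assumes "k \<le> n" "v \<in> {1..n}"
  shows "position (folded_order k n) v = (if v \<le> k then v - 1 else n + k - v)"
proof -
  let ?i = "if v \<le> k then v - 1 else n + k - v"
  have "?i < length (folded_order k n)" using assms by (auto simp: length_folded_order)
  moreover have "folded_order k n ! ?i = v"
    using assms by (auto simp: folded_order_def nth_append rev_nth simp del: upt_Suc)
  moreover have "distinct (folded_order k n)"
    using cyclic_order_on_folded_order[OF assms(1)] by (simp add: cyclic_order_on_def)
  ultimately show ?thesis using position_nth by metis
qed

text \<open>The color of a chord is its direction.\<close>

lemma matching_book_embedding_parallel:
  assumes simple: "simple_graph G" and order: "cyclic_order_on (verts G) \<omega>"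
  shows "matching_book_embedding G \<omega> (\<lambda>e. (\<Sum>v\<in>e. position \<omega> v) mod length \<omega>)"
proof -
  define n where "n = length \<omega>"
  define \<zeta> where "\<zeta> = cis (2 * pi / real n)"
  have dist: "distinct \<omega>" and set: "set \<omega> = verts G"
    using order by (auto simp: cyclic_order_on_def)
  have P: "point \<omega> v = \<zeta> ^ position \<omega> v" for v
    by (simp add: point_position \<zeta>_def n_def Complex.DeMoivre mult_ac)
  \<comment> \<open>Any common point of two chords of the same color, endpoint or not, forces the
    edges to be equal. This gives both requirements on a page, no crossing and no shared
    endpoint.\<close>
  have same: "e = f"
    if e: "e \<in> edges G" and f: "f \<in> edges G"
      and col: "(\<Sum>v\<in>e. position \<omega> v) mod n = (\<Sum>v\<in>f. position \<omega> v) mod n"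
      and z: "z \<in> chord \<omega> e" "z \<in> chord \<omega> f" for e f z
  proof -
    have cards: "card e = 2" "card f = 2" and sub: "e \<subseteq> set \<omega>" "f \<subseteq> set \<omega>"
      using simple e f set by (auto simp: simple_graph_def)
    then obtain a b a' b' where ab: "e = {a, b}" "a \<noteq> b" "f = {a', b'}" "a' \<noteq> b'"
      unfolding card_2_iff by blast
    have "n > 0" using sub ab by (auto simp: n_def)
    then have "\<zeta> ^ n = 1" by (simp add: \<zeta>_def Complex.DeMoivre)
    then have pow: "\<zeta> ^ m = \<zeta> ^ (m mod n)" for m
      by (metis mod_mult_div_eq mult.right_neutral power_add power_mult power_one)
    \<comment> \<open>Points are powers of \<open>\<zeta>\<close>, so equal position sums modulo
      \<open>n\<close> are equal products, the algebraic form of parallelism.\<close>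
    have "point \<omega> a * point \<omega> b = point \<omega> a' * point \<omega> b'"
      using col ab unfolding P power_add[symmetric] by (subst (1 2) pow) simp
    moreover have "norm (point \<omega> v) = 1" for v by (simp add: point_def)
    ultimately have "point \<omega> ` e = point \<omega> ` f"
      using z parallel_chords_disjoint[of "point \<omega> a" "point \<omega> b" "point \<omega> a'" "point \<omega> b'" z] ab
      by (simp add: chord_def)
    then show "e = f" using inj_on_image_eq_iff[OF inj_on_point[OF dist] sub] by simp
  qed
  have endpoint: "point \<omega> v \<in> chord \<omega> e" if "v \<in> e" for v e
    using that unfolding chord_def by (intro hull_inc) auto
  show ?thesis
    unfolding matching_book_embedding_def crosses_def n_def[symmetric]
    using simple order same endpoint by blast
qed

text \<open>A jump \<open>{a, a + k}\<close> with \<open>a \<le> k\<close> has position sum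
  \<open>n - 1\<close>; for \<open>n = 2 * k + 1\<close> a pair \<open>{a, a + k + 1}\<close> with
  \<open>a \<le> k\<close> has sum \<open>n - 2\<close>. These removed pairs exhaust the colors from
  \<open>2 * k - 1\<close> on. In the odd case the remaining removed pair
  \<open>{k + 1, 2 * k + 1}\<close> has color \<open>k - 1\<close>, which only makes that page
  smaller.\<close>

lemma folded_order_colors:
  assumes k: "n div 2 = k" "1 \<le> k" and e: "e \<in> edges (circulant n {1..k - 1})"
  shows "(\<Sum>v\<in>e. position (folded_order k n) v) mod n < 2 * k - 1"
proof -
  have n: "n = 2 * k \<or> n = 2 * k + 1" using k by linarith
  have S: "{1..k - 1} \<subseteq> {1..<n}" using n by auto
  have "e \<subseteq> {1..n}" "card e = 2"
    using simple_graph_circulant[OF S] e by (auto simp: simple_graph_def circulant_def)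
  then obtain a b where ab: "a \<in> {1..n}" "b \<in> {1..n}" "a < b" "e = {a, b}"
    by (metis card_2_iff insert_commute insert_subset linorder_neqE_nat)
  have d: "b - a \<noteq> k" "b - a \<noteq> n - k"
    using circulant_edge_iff[OF S ab(1-3)] e ab n k by auto
  define s where "s = (\<Sum>v\<in>e. position (folded_order k n) v)"
  have "k \<le> n" using n by auto
  then have s: "s = (if a \<le> k then a - 1 else n + k - a) + (if b \<le> k then b - 1 else n + k - b)"
    using ab position_folded_order[of k n] by (simp add: s_def)
  \<comment> \<open>Distinct positions sum to at most \<open>2 * n - 3\<close>, so a sum of at least
    \<open>n\<close> reduces to at most \<open>n - 3\<close>. It remains to exclude the sums from
    \<open>2 * k - 1\<close> to \<open>n - 1\<close>, which \<open>d\<close> does.\<close>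
  have "s < 2 * k - 1 \<or> n \<le> s \<and> s - n < 2 * k - 1"
    unfolding s using n ab d k(2) by (auto split: if_splits)
  then show ?thesis unfolding s_def[symmetric]
    by (metis le_mod_geq mod_less_eq_dividend order_le_less_trans)
qed

text \<open>Every embedding has at least \<open>d\<close> pages, and \<open>no\<close> excludes
  equality for every cyclic order. Hence \<open>d + 1\<close> is a lower bound throughout, and the
  given embedding attains it.\<close>

lemma nearly_dispersable_if_regular:
  assumes "verts G \<noteq> {}" and reg: "\<And>v. v \<in> verts G \<Longrightarrow> degree G v = d"
    and no: "\<And>\<omega> c. matching_book_embedding G \<omega> c \<Longrightarrow> num_pages G c \<noteq> d"
    and emb: "matching_book_embedding G \<omega> c" "num_pages G c \<le> d + 1"
  shows "nearly_dispersable G" and "mbt G \<omega> = d + 1"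
proof -
  have "degree G ` verts G = {d}" using assms(1) reg by auto
  then have max: "max_degree G = d" by (simp add: max_degree_def)
  have lower: "d + 1 \<le> num_pages G c'" if "matching_book_embedding G \<omega>' c'" for \<omega>' c'
    using degree_le_num_pages[OF that] reg no[OF that] assms(1)
    by (metis Suc_eq_plus1 Suc_leI ex_in_conv le_neq_implies_less)
  have eq: "num_pages G c = d + 1" using lower[OF emb(1)] emb(2) by simp
  then show "nearly_dispersable G"
    using emb(1) no max by (auto simp: nearly_dispersable_def dispersable_def)
  show "mbt G \<omega> = d + 1"
    unfolding mbt_def using emb(1) eq lower by (intro Least_equality) auto
qed

text \<open>The condition \<open>n div 2 = k\<close> treats the even and the odd graph
  together.\<close>

lemma circulant_nearly_dispersable:
  assumes k: "n div 2 = k" "3 \<le> k"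
  shows "nearly_dispersable (circulant n {1..k - 1})"
    and "mbt (circulant n {1..k - 1}) (folded_order k n) = 2 * k - 1"
proof -
  let ?G = "circulant n {1..k - 1}" and ?\<omega> = "folded_order k n"
  let ?c = "\<lambda>e. (\<Sum>v\<in>e. position ?\<omega> v) mod n"
  have n: "n = 2 * k \<or> n = 2 * k + 1" using k by linarith
  have S: "{1..k - 1} \<subseteq> {1..<n}" using n by auto
  have V: "verts ?G = {1..n}" by (simp add: circulant_def)
  have reg: "degree ?G v = 2 * (k - 1)" if "v \<in> verts ?G" for v
    using that n k unfolding V by (intro degree_circulant_interval) auto
  \<comment> \<open>Here \<open>3 \<le> k\<close> enters: the jumps 1 and 2 both lie in
    \<open>{1..k - 1}\<close>.\<close>
  have triangle: "{1, 2} \<in> edges ?G" "{2, 3} \<in> edges ?G" "{1, 3} \<in> edges ?G"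
    using n k by (subst circulant_edge_iff[OF S]; auto)+
  have no: "num_pages ?G c \<noteq> 2 * (k - 1)" if emb: "matching_book_embedding ?G \<omega> c" for \<omega> c
  proof
    assume "num_pages ?G c = 2 * (k - 1)"
    then have "even (position \<omega> u) \<noteq> even (position \<omega> v)" if "{u, v} \<in> edges ?G" for u v
      using regular_num_pages_bipartite[OF emb _ that] reg that by force
    \<comment> \<open>Three mutually adjacent vertices would need three different parities.\<close>
    then show False using triangle by blast
  qed
  have emb: "matching_book_embedding ?G ?\<omega> ?c"
    using matching_book_embedding_parallel[OF simple_graph_circulant[OF S], of ?\<omega>]
      cyclic_order_on_folded_order[of k n] n unfolding V by (auto simp: length_folded_order)
  have "?c ` edges ?G \<subseteq> {..<2 * k - 1}" using folded_order_colors[OF k(1)] k(2) by auto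
  then have "num_pages ?G ?c \<le> card {..<2 * k - 1}"
    unfolding num_pages_def by (intro card_mono) auto
  then have pages: "num_pages ?G ?c \<le> 2 * (k - 1) + 1" using k(2) by simp
  have "verts ?G \<noteq> {}" unfolding V using n k(2) by auto
  note * = nearly_dispersable_if_regular[OF this reg no emb pages]
  show "nearly_dispersable ?G" by (rule *)
  show "mbt ?G ?\<omega> = 2 * k - 1" using *(2) k(2) by simp
qed

theorem theorem8:
  fixes k :: nat
  assumes "k \<ge> 3"
  shows
    "nearly_dispersable (cocktail_party k) \<and>
     nearly_dispersable (odd_cycle_complement k) \<and>
     mbt (cocktail_party k) (folded_order k (2 * k)) = 2 * k - 1 \<and>
     mbt (odd_cycle_complement k) (folded_order k (2 * k + 1)) = 2 * k - 1"
  using circulant_nearly_dispersable[of "2 * k" k] circulant_nearly_dispersable[of "2 * k + 1" k] assms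
  by (simp add: cocktail_party_def odd_cycle_complement_def)

end
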